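(* Fix $d\in\mathbb{N}$. For each $m\in\mathbb{N}$ let $P_m$ be a monic polynomial of degree $m$ with only real roots. Assume that, as $m\to\infty$, $m_1(P_m)=o(m^{-1/2})$, $m_2(P_m)\to1$, and $|m|_{2+\varepsilon}(P_m)=o(m^{\varepsilon/2})$ for some $\varepsilon>0$. Then $$\lim_{n\to\infty}\frac{1}{(n+d)_n}\left(\frac{d}{dz}\right)^{n}\bigl(\mathfrak{D}_{\sqrt{n+d}}\,P_{d+n}\bigr)(z)=\operatorname{He}_d(z)$$ uniformly on compact subsets of the complex plane.
   Context: For a polynomial $P$ of degree $m$ with roots $\lambda_1,\dots,\lambda_m$ (counted with multiplicity), $m_j(P)=\frac1m\sum_{i=1}^m\lambda_i^j$ and, for real $s>0$, $|m|_s(P)=\frac1m\sum_{i=1}^m|\lambda_i|^s$. For positive integers $N,j$, $(N)_j=\prod_{i=1}^j(N-i+1)$ is the falling factorial. For $k>0$ the dilation of a polynomial $p$ is $\mathfrak{D}_kp(z)=k^{\deg(p)}p(z/k)$. The Hermite polynomial is $\operatorname{He}_d(z)=\sum_{k=0}^{\lfloor d/2\rfloor}\frac{d!\,(-1)^k}{k!\,(d-2k)!}\frac{z^{d-2k}}{2^k}$. *)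

theory Defs
  imports
    "HOL-Analysis.Analysis"
    "HOL-Computational_Algebra.Computational_Algebra"
    "HOL-Library.Landau_Symbols"
begin

(* The roots are counted with multiplicity: proots is a multiset. *)
definition root_moment :: "nat \<Rightarrow> complex poly \<Rightarrow> complex" where
  "root_moment j P = (\<Sum>z\<in>#proots P. z ^ j) / of_nat (degree P)"

definition abs_root_moment :: "real \<Rightarrow> complex poly \<Rightarrow> real" where
  "abs_root_moment s P = (\<Sum>z\<in>#proots P. norm z powr s) / real (degree P)"

definition falling_factorial :: "nat \<Rightarrow> nat \<Rightarrow> int" where
  "falling_factorial N j = (\<Prod>i=1..j. int N - int i + 1)"

(* The linear polynomial [:0, 1 / k:] is z / k. The dilation is only meaningful for k > 0. *)
definition dilation :: "real \<Rightarrow> complex poly \<Rightarrow> complex poly" where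
  "dilation k p = smult (of_real k ^ degree p) (pcompose p [:0, 1 / of_real k:])"

definition hermite_poly :: "nat \<Rightarrow> complex poly" where
  "hermite_poly d =
     (\<Sum>k=0..d div 2. monom (fact d * (-1) ^ k / (fact k * fact (d - 2 * k)) / 2 ^ k) (d - 2 * k))"

end

theory Submission
  imports Defs
begin

text \<open>
  Put \<open>m = n + d\<close> and let \<open>x\<^sub>i = \<lambda>\<^sub>i / sqrt m\<close> be the rescaled roots of \<open>P\<^sub>m\<close>. Dilating by \<open>sqrt m\<close>,
  differentiating \<open>n\<close> times and normalising leaves a polynomial of degree at most \<open>d\<close> whose
  coefficient at \<open>z ^ (d - k)\<close> is \<open>d! / (d - k)!\<close> times the coefficient of \<open>t ^ k\<close> in
  \<open>\<Prod>i. (1 - x\<^sub>i t)\<close>, up to the factor \<open>m ^ k (m - k)! / m!\<close>, which tends to 1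
  (\<open>coeff_rescaled_derivative\<close>, \<open>fact_ratio_tendsto\<close>). As the degrees are bounded, it is enough to
  find the limit of each of these coefficients (\<open>uniform_limit_poly\<close>).

  Formally, \<open>\<Prod>i. (1 - x\<^sub>i t) = exp (- q\<^sub>1 t - q\<^sub>2 t\<^sup>2 / 2 - q\<^sub>3 t\<^sup>3 / 3 - \<dots>)\<close> where \<open>q\<^sub>j\<close> is the sum
  of the \<open>x\<^sub>i ^ j\<close>. The hypotheses on the first two moments say that \<open>q\<^sub>1\<close> tends to 0 and \<open>q\<^sub>2\<close> to 1.
  The one on the moment of order \<open>2 + \<epsilon>\<close> says that the sum of the \<open>\<bar>x\<^sub>i\<bar> powr (2 + \<epsilon>)\<close> tends to 0,
  so the largest \<open>\<bar>x\<^sub>i\<bar>\<close> does; since \<open>\<bar>q\<^sub>j\<bar> \<le> (max \<bar>x\<^sub>i\<bar>) ^ (j - 2) q\<^sub>2\<close> for real roots, all \<open>q\<^sub>j\<close> with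
  \<open>j \<ge> 3\<close> vanish in the limit (\<open>real_power_sum_le\<close>). Hence the product tends coefficientwise to
  \<open>exp (- t\<^sup>2 / 2)\<close>, whose coefficients are those of the Hermite polynomial after the factors
  \<open>d! / (d - k)!\<close> are restored (\<open>coeff_hermite_poly\<close>).

  Newton's identities replace the exponential: they express each coefficient of the product as a
  finite combination of the earlier ones and the \<open>q\<^sub>j\<close>, so limits pass through them by induction
  (\<open>Newton_identity\<close>, \<open>Newton_recursion_limit\<close>).
\<close>

section \<open>Newton's identities\<close>

text \<open>
  The logarithmic derivative of \<open>1 - x X\<close> is \<open>- x / (1 - x X)\<close>, a geometric series with the
  coefficients \<open>- x ^ (n + 1)\<close>. Logarithmic derivatives of products add up, which produces power
  sums.
\<close>
lemma fps_deriv_reversed_product: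
  fixes A :: "complex multiset"
  shows "fps_deriv (\<Prod>x\<in>#A. 1 - fps_const x * fps_X) =
           - ((\<Prod>x\<in>#A. 1 - fps_const x * fps_X) * Abs_fps (\<lambda>n. \<Sum>x\<in>#A. x ^ Suc n))"
proof (induction A)
  case empty
  have "Abs_fps (\<lambda>n. 0 :: complex) = 0" by (simp add: fps_eq_iff)
  then show ?case by simp
next
  case (add a A)
  define S where "S = Abs_fps (\<lambda>n. \<Sum>x\<in>#A. x ^ Suc n)"
  define G where "G = Abs_fps (\<lambda>n. a ^ Suc n)"
  define F where "F = (\<Prod>x\<in>#A. 1 - fps_const x * fps_X)"
  have sum: "Abs_fps (\<lambda>n. \<Sum>x\<in>#add_mset a A. x ^ Suc n) = G + S"
    by (simp add: fps_eq_iff G_def S_def)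
  have geometric: "(1 - fps_const a * fps_X) * G = fps_const a"
  proof (rule fps_ext)
    fix n
    show "((1 - fps_const a * fps_X) * G) $ n = fps_const a $ n"
      by (cases n) (simp_all add: G_def left_diff_distrib mult.assoc)
  qed
  define c where "c = fps_const a"
  have "fps_deriv (1 - c * fps_X) = - c" by (simp add: c_def)
  then have "fps_deriv ((1 - c * fps_X) * F) = (1 - c * fps_X) * fps_deriv F - c * F"
    by (simp only: fps_deriv_mult) simp
  also have "\<dots> = - (((1 - c * fps_X) * F) * S) - ((1 - c * fps_X) * G) * F"
    using add.IH by (simp only: geometric c_def F_def S_def) (simp add: mult_ac)
  also have "\<dots> = - (((1 - c * fps_X) * F) * (G + S))"
    by (simp add: algebra_simps)
  finally show ?case
    unfolding sum unfolding F_def c_def by simp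
qed

text \<open>
  The reflected polynomial of a monic \<open>P\<close> is the product of the \<open>1 - z X\<close> over the roots \<open>z\<close> of
  \<open>P\<close>, so this compares the coefficients of \<open>X ^ k\<close> in the formula for its derivative. Reflection
  lets the identity hold for every \<open>k\<close>, also beyond the degree.
\<close>
lemma Newton_identity:
  fixes P :: "complex poly"
  assumes "lead_coeff P = 1"
  shows "of_nat (Suc k) * coeff (reflect_poly P) (Suc k) =
     - (\<Sum>j\<le>k. coeff (reflect_poly P) (k - j) * (\<Sum>z\<in>#proots P. z ^ Suc j))"
proof -
  have refl: "reflect_poly (\<Prod>x\<in>#A. [:-x, 1:]) = (\<Prod>x\<in>#A. [:1, -x:])" for A :: "complex multiset"
  proof (induction A)
    case (add x A)
    have "reflect_poly [:-x, 1:] = [:1, -x:]" by (cases "x = 0") (simp_all add: reflect_poly_pCons reflect_poly_pCons' cCons_def)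
    then show ?case by (simp only: image_mset_add_mset prod_mset.add_mset reflect_poly_mult add.IH)
  qed simp
  have fps: "fps_of_poly (\<Prod>x\<in>#A. [:1, -x:]) = (\<Prod>x\<in>#A. 1 - fps_const x * fps_X)"
    for A :: "complex multiset"
  proof (induction A)
    case (add x A)
    have "fps_of_poly [:1, -x:] = 1 - fps_const x * fps_X"
      unfolding fps_of_poly_linear' by (simp add: fps_const_neg [symmetric] del: fps_const_neg)
    then show ?case by (simp only: image_mset_add_mset prod_mset.add_mset fps_of_poly_mult add.IH)
  qed simp
  define F where "F = fps_of_poly (reflect_poly P)"
  have "P = (\<Prod>x\<in>#proots P. [:-x, 1:])"
    using complex_poly_decompose_multiset [of P] assms by simp
  then have "F = (\<Prod>x\<in>#proots P. 1 - fps_const x * fps_X)"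
    unfolding F_def using refl fps by metis
  then have "fps_deriv F $ k = (- (F * Abs_fps (\<lambda>n. \<Sum>x\<in>#proots P. x ^ Suc n))) $ k"
    using fps_deriv_reversed_product by metis
  also have "\<dots> = - (\<Sum>j\<le>k. F $ (k - j) * (\<Sum>z\<in>#proots P. z ^ Suc j))"
    by (subst mult.commute) (simp add: fps_mult_nth atMost_atLeast0 mult.commute [of "F $ _"])
  finally show ?thesis by (simp add: F_def)
qed

section \<open>The limiting coefficients\<close>

text \<open>The Taylor coefficients of \<open>exp (- t\<^sup>2 / 2)\<close>.\<close>
definition gauss_coeff :: "nat \<Rightarrow> complex" where
  "gauss_coeff k = (if even k then (-1) ^ (k div 2) / (2 ^ (k div 2) * fact (k div 2)) else 0)"

lemma gauss_coeff_0 [simp]: "gauss_coeff 0 = 1"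
  and gauss_coeff_1 [simp]: "gauss_coeff (Suc 0) = 0"
  by (simp_all add: gauss_coeff_def)

text \<open>
  The differential equation \<open>f' = - t f\<close> of the Gaussian. It is also Newton's recursion for
  \<open>q\<^sub>2 = 1\<close> and \<open>q\<^sub>j = 0\<close> otherwise.
\<close>
lemma gauss_coeff_Suc_Suc:
  "of_nat (Suc (Suc k)) * gauss_coeff (Suc (Suc k)) = - gauss_coeff k"
proof (cases "even k")
  case True
  then obtain l where k: "k = 2 * l" by blast
  have "of_nat (Suc (Suc k)) = 2 * (1 + of_nat l :: complex)" by (simp add: k)
  moreover have "gauss_coeff (Suc (Suc k)) = - ((-1) ^ l) / (2 * 2 ^ l * ((1 + of_nat l) * fact l))"
    by (simp add: gauss_coeff_def k)
  moreover have "2 * c * (- u / (2 * v * (c * w))) = - (u / (v * w))" if "c \<noteq> 0" for c u v w :: complex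
    using that by simp
  moreover have "(1 + of_nat l :: complex) \<noteq> 0"
    by (metis of_nat_Suc of_nat_eq_0_iff nat.distinct(1))
  ultimately have "of_nat (Suc (Suc k)) * gauss_coeff (Suc (Suc k)) = - ((-1) ^ l / (2 ^ l * fact l))"
    by metis
  then show ?thesis by (simp add: gauss_coeff_def k)
qed (simp add: gauss_coeff_def)

text \<open>
  Reading off coefficients turns the explicit sum into the generating function
  \<open>exp (z t - t\<^sup>2 / 2)\<close> of the Hermite polynomials.
\<close>
lemma coeff_hermite_poly:
  "coeff (hermite_poly d) i = (if i \<le> d then fact d / fact i * gauss_coeff (d - i) else 0)"
proof -
  have "coeff (hermite_poly d) i =
      (\<Sum>k=0..d div 2. if d - 2 * k = i then fact d * (-1) ^ k / (fact k * fact (d - 2 * k)) / 2 ^ k else 0)"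
    by (simp add: hermite_poly_def coeff_sum cong: if_cong)
  also have "\<dots> = (if i \<le> d then fact d / fact i * gauss_coeff (d - i) else 0)"
  proof (cases "i \<le> d \<and> even (d - i)")
    case True
    then obtain l where l: "d = i + 2 * l" by (metis dvd_def le_add_diff_inverse)
    have "(d - 2 * k = i) = (k = l)" if "k \<in> {0..d div 2}" for k using that l by auto
    then have "(\<Sum>k=0..d div 2. if d - 2 * k = i then fact d * (-1) ^ k / (fact k * fact (d - 2 * k)) / 2 ^ k else 0)
      = (\<Sum>k=0..d div 2. if k = l then fact d * (-1) ^ k / (fact k * fact (d - 2 * k)) / 2 ^ k else (0 :: complex))"
      by (intro sum.cong) auto
    also have "\<dots> = fact d * (-1) ^ l / (fact l * fact (d - 2 * l)) / 2 ^ l"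
      using l by (subst sum.delta) auto
    finally show ?thesis using l by (simp add: gauss_coeff_def mult_ac)
  next
    case False
    have "d - 2 * k \<noteq> i" if "k \<in> {0..d div 2}" for k
    proof
      assume "d - 2 * k = i"
      with that have "d = i + 2 * k" by auto
      with False show False by simp
    qed
    then have "(\<Sum>k=0..d div 2. if d - 2 * k = i then fact d * (-1) ^ k / (fact k * fact (d - 2 * k)) / 2 ^ k else 0)
       = (0 :: complex)"
      by (intro sum.neutral) auto
    then show ?thesis using False by (auto simp: gauss_coeff_def)
  qed
  finally show ?thesis .
qed

text \<open>
  By strong induction every summand of the recursion converges. In the limit only the one with
  \<open>j = 1\<close>, which carries the second power sum, survives, and what is left is the recursion of
  the Gaussian coefficients.
\<close>
lemma Newton_recursion_limit:
  fixes b q :: "nat \<Rightarrow> nat \<Rightarrow> complex"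
  assumes init: "eventually (\<lambda>m. b m 0 = 1) F"
    and rec: "\<And>k. eventually (\<lambda>m. of_nat (Suc k) * b m (Suc k) = - (\<Sum>j\<le>k. b m (k - j) * q m (Suc j))) F"
    and lim: "\<And>j. ((\<lambda>m. q m (Suc j)) \<longlongrightarrow> (if j = 1 then 1 else 0)) F"
  shows "((\<lambda>m. b m k) \<longlongrightarrow> gauss_coeff k) F"
proof (induction k rule: less_induct)
  case (less k)
  show ?case
  proof (cases k)
    case 0
    then show ?thesis using tendsto_eventually [OF init] by simp
  next
    case (Suc l)
    have "((\<lambda>m. - (\<Sum>j\<le>l. b m (l - j) * q m (Suc j)) / of_nat (Suc l))
        \<longlongrightarrow> - (\<Sum>j\<le>l. gauss_coeff (l - j) * (if j = 1 then 1 else 0)) / of_nat (Suc l)) F"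
      by (intro tendsto_intros lim less.IH) (auto simp: Suc simp del: of_nat_Suc)
    also have "(\<Sum>j\<le>l. gauss_coeff (l - j) * (if j = 1 then 1 else 0)) =
        (\<Sum>j\<le>l. if j = 1 then gauss_coeff (l - j) else 0)"
      by (intro sum.cong) auto
    also have "\<dots> = (if 1 \<le> l then gauss_coeff (l - 1) else 0)"
      by (subst sum.delta) auto
    also have "- \<dots> / of_nat (Suc l) = gauss_coeff k"
    proof (cases l)
      case (Suc i)
      have "gauss_coeff k = - gauss_coeff i / of_nat (Suc l)"
        using gauss_coeff_Suc_Suc [of i] \<open>k = Suc l\<close> Suc
        by (metis nonzero_mult_div_cancel_left of_nat_neq_0)
      then show ?thesis by (simp add: Suc del: of_nat_Suc)
    qed (simp add: Suc)
    finally have "((\<lambda>m. - (\<Sum>j\<le>l. b m (l - j) * q m (Suc j)) / of_nat (Suc l)) \<longlongrightarrow> gauss_coeff k) F" .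
    moreover have "eventually (\<lambda>m. - (\<Sum>j\<le>l. b m (l - j) * q m (Suc j)) / of_nat (Suc l) = b m k) F"
      using rec [of l]
    proof eventually_elim
      case (elim m)
      show ?case by (simp add: elim [symmetric] Suc del: of_nat_Suc)
    qed
    ultimately show ?thesis by (rule Lim_transform_eventually)
  qed
qed

section \<open>Power sums of real numbers\<close>

lemma norm_sum_mset_le:
  fixes f :: "'a \<Rightarrow> 'b :: real_normed_vector"
  shows "norm (\<Sum>x\<in>#A. f x) \<le> (\<Sum>x\<in>#A. norm (f x))"
  by (induction A) (auto intro: order_trans [OF norm_triangle_ineq])

text \<open>
  Each \<open>\<bar>z\<bar>\<close> is at most the \<open>s\<close>-norm of the family, so \<open>j\<close> of the \<open>j + 2\<close> factors of \<open>\<bar>z\<bar> ^ (j + 2)\<close>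
  can be bounded by that norm. Reality enters because then \<open>\<bar>z\<bar>\<^sup>2 = z\<^sup>2\<close>, so that there is no
  cancellation in the second power sum.
\<close>
lemma real_power_sum_le:
  fixes A :: "complex multiset"
  assumes real: "\<And>z. z \<in># A \<Longrightarrow> z \<in> \<real>" and s: "s > 0"
  shows "norm (\<Sum>z\<in>#A. z ^ (j + 2)) \<le>
     ((\<Sum>z\<in>#A. norm z powr s) powr (1 / s)) ^ j * norm (\<Sum>z\<in>#A. z ^ 2)"
proof -
  define M where "M = (\<Sum>z\<in>#A. norm z powr s) powr (1 / s)"
  have max: "norm z \<le> M" if z: "z \<in># A" for z
  proof -
    obtain B where "A = add_mset z B" using multi_member_split [OF z] by blast
    moreover have "0 \<le> (\<Sum>z\<in>#B. norm z powr s)"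
      by (induction B) auto
    ultimately have "norm z powr s \<le> (\<Sum>z\<in>#A. norm z powr s)" by simp
    then have "(norm z powr s) powr (1 / s) \<le> M"
      unfolding M_def using s by (intro powr_mono2) auto
    then show ?thesis using s by (simp add: powr_powr)
  qed
  have "norm (\<Sum>z\<in>#A. z ^ (j + 2)) \<le> (\<Sum>z\<in>#A. norm (z ^ (j + 2)))"
    by (rule norm_sum_mset_le)
  also have "\<dots> \<le> (\<Sum>z\<in>#A. M ^ j * norm z ^ 2)"
  proof (rule sum_mset_mono)
    fix z
    assume "z \<in># A"
    then have "norm z ^ j * norm z ^ 2 \<le> M ^ j * norm z ^ 2"
      using max by (intro mult_right_mono power_mono) auto
    then show "norm (z ^ (j + 2)) \<le> M ^ j * norm z ^ 2"
      by (simp only: norm_power norm_mult power_add)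
  qed
  also have "\<dots> = M ^ j * (\<Sum>z\<in>#A. norm z ^ 2)"
    by (simp add: sum_mset_distrib_left)
  also have "(\<Sum>z\<in>#A. norm z ^ 2) = norm (\<Sum>z\<in>#A. z ^ 2)"
  proof -
    have square: "z ^ 2 = (of_real (norm z)) ^ 2" if "z \<in> \<real>" for z :: complex
      using that by (auto elim!: Reals_cases simp flip: of_real_power)
    have "(\<Sum>z\<in>#A. z ^ 2) = of_real (\<Sum>z\<in>#A. norm z ^ 2)"
      using real
    proof (induction A)
      case (add x A)
      then show ?case using square [of x] by simp
    qed simp
    moreover have "0 \<le> (\<Sum>z\<in>#A. norm z ^ 2)" by (induction A) auto
    ultimately show ?thesis by simp
  qed
  finally show ?thesis unfolding M_def .
qed

section \<open>Coefficients of the rescaled derivative\<close>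

text \<open>
  Passing from \<open>k\<close> to \<open>k + 1\<close> multiplies the ratio by \<open>m / (m - k) = 1 / (1 - k / m)\<close>.
\<close>
lemma fact_ratio_tendsto:
  "(\<lambda>m. of_nat m ^ k * fact (m - k) / fact m :: complex) \<longlonglongrightarrow> 1"
proof (induction k)
  case (Suc k)
  have "(\<lambda>m. 1 - of_nat k * (1 / of_nat m) :: complex) \<longlonglongrightarrow> 1 - of_nat k * 0"
    by (intro tendsto_intros lim_1_over_n)
  then have "(\<lambda>m. inverse (1 - of_nat k * (1 / of_nat m)) :: complex) \<longlonglongrightarrow> inverse 1"
    by (intro tendsto_inverse) auto
  then have "(\<lambda>m. of_nat m ^ k * fact (m - k) / fact m * inverse (1 - of_nat k * (1 / of_nat m)) :: complex)
      \<longlonglongrightarrow> 1 * inverse 1"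
    by (intro tendsto_mult Suc.IH)
  moreover have "eventually (\<lambda>m. of_nat m ^ k * fact (m - k) / fact m * inverse (1 - of_nat k * (1 / of_nat m))
       = (of_nat m ^ Suc k * fact (m - Suc k) / fact m :: complex)) sequentially"
    using eventually_gt_at_top [of k]
  proof eventually_elim
    case (elim m)
    have f: "fact (m - k) = (of_nat m - of_nat k) * (fact (m - Suc k) :: complex)"
      using elim by (subst fact_reduce) (auto simp: of_nat_diff)
    have "of_nat m \<noteq> (0 :: complex)" "of_nat m - of_nat k \<noteq> (0 :: complex)" using elim by auto
    then show ?case by (simp add: f field_simps)
  qed
  ultimately show ?case by (simp add: Lim_transform_eventually)
qed simp

text \<open>
  A bounded number of monomials, each bounded on \<open>K\<close>, so convergence of the coefficients is
  uniform in \<open>z\<close>.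
\<close>
lemma uniform_limit_poly:
  fixes p :: "'i \<Rightarrow> complex poly"
  assumes deg: "eventually (\<lambda>n. degree (p n) \<le> d) F" "degree q \<le> d"
    and lim: "\<And>i. i \<le> d \<Longrightarrow> ((\<lambda>n. coeff (p n) i) \<longlongrightarrow> coeff q i) F"
    and K: "compact K"
  shows "uniform_limit K (\<lambda>n. poly (p n)) (poly q) F"
proof -
  have expand: "(\<Sum>i\<le>d. coeff r i * z ^ i) = poly r z" if "degree r \<le> d" for r and z :: complex
    using poly_as_sum_of_monoms' [OF that] by (metis (no_types, lifting) poly_monom poly_sum sum.cong)
  have bdd: "bounded ((\<lambda>z. z ^ i) ` K)" for i
    by (intro compact_imp_bounded compact_continuous_image K continuous_intros)
  have const: "uniform_limit K (\<lambda>n z. coeff (p n) i) (\<lambda>z. coeff q i) F" if "i \<le> d" for i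
    using tendstoD [OF lim [OF that]] by (auto simp: uniform_limit_iff elim: eventually_mono)
  have term_lim: "uniform_limit K (\<lambda>n z. coeff (p n) i * z ^ i) (\<lambda>z. coeff q i * z ^ i) F" if "i \<le> d" for i
    by (intro uniform_lim_mult const that uniform_limit_const bdd) (auto intro: finite_imp_bounded finite_subset [of _ "{coeff q i}"])
  have partial: "uniform_limit K (\<lambda>n z. \<Sum>i\<in>I. coeff (p n) i * z ^ i) (\<lambda>z. \<Sum>i\<in>I. coeff q i * z ^ i) F"
    if "finite I" "I \<subseteq> {..d}" for I
    using that by (induction I) (auto intro!: uniform_limit_const uniform_limit_add term_lim)
  have "uniform_limit K (\<lambda>n z. \<Sum>i\<le>d. coeff (p n) i * z ^ i) (\<lambda>z. \<Sum>i\<le>d. coeff q i * z ^ i) F"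
    by (rule partial) auto
  then show ?thesis
    by (rule uniform_limit_cong [THEN iffD1, rotated 2])
       (use deg expand in \<open>auto elim: eventually_mono\<close>)
qed

lemma falling_factorial_eq_pochhammer:
  "(of_int (falling_factorial (n + d) n) :: complex) = pochhammer (of_nat (Suc d)) n"
proof -
  have "(of_int (falling_factorial (n + d) n) :: complex) = (\<Prod>i=1..n. of_nat (n + d) - of_nat i + 1)"
    by (simp add: falling_factorial_def)
  also have "\<dots> = (\<Prod>i=0..<n. of_nat (Suc d) + of_nat i)"
    by (rule prod.reindex_bij_witness [of _ "\<lambda>i. n - i" "\<lambda>i. n - i"]) (auto simp: of_nat_diff)
  finally show ?thesis by (simp add: pochhammer_prod)
qed

lemma pochhammer_Suc_eq_fact:
  "pochhammer (of_nat (Suc i) :: complex) n = fact (i + n) / fact i"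
  using pochhammer_product' [of "1 :: complex" i n] by (simp add: pochhammer_fact [symmetric] field_simps)

text \<open>
  With \<open>k = d - i\<close> and \<open>s\<^sup>2 = n + d\<close>, dilation and differentiation multiply the coefficient of
  \<open>p\<close> at \<open>n + i\<close> by \<open>s ^ k\<close> and a ratio of factorials. Writing \<open>s ^ k = (n + d) ^ k / s ^ k\<close> splits this
  into a factor that tends to a constant and the coefficient that the reflected polynomial has
  once the roots of \<open>p\<close> are divided by \<open>s\<close>.
\<close>
lemma coeff_rescaled_derivative:
  fixes p :: "complex poly"
  assumes deg: "degree p = n + d" and pos: "n + d > 0" and i: "i \<le> d"
  shows "1 / of_int (falling_factorial (n + d) n) *
           coeff ((pderiv ^^ n) (dilation (sqrt (real (n + d))) p)) i =
         fact d / fact i * (of_nat (n + d) ^ (d - i) * fact (n + d - (d - i)) / fact (n + d))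
           * (coeff (reflect_poly p) (d - i) / of_real (sqrt (real (n + d))) ^ (d - i))"
proof -
  define s :: complex where "s = of_real (sqrt (real (n + d)))"
  define k where "k = d - i"
  have s: "s \<noteq> 0" unfolding s_def of_real_eq_0_iff real_sqrt_eq_zero_cancel_iff of_nat_eq_0_iff
    using pos by simp
  have sq: "s * s = of_nat (n + d)"
    by (simp add: s_def flip: of_real_mult)
  have d: "d = i + k" using i by (simp add: k_def)
  have c: "coeff (reflect_poly p) k = coeff p (n + i)"
    using d deg by (simp add: coeff_reflect_poly)
  have "s ^ (n + d) * (1 / s) ^ (n + i) = s ^ k"
    using s by (simp add: d power_add field_simps)
  also have "\<dots> = of_nat (n + d) ^ k / s ^ k"
    unfolding sq [symmetric] using s by (simp add: power_mult_distrib)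
  finally have pw: "s ^ (n + d) * (1 / s) ^ (n + i) = of_nat (n + d) ^ k / s ^ k" .
  have "coeff ((pderiv ^^ n) (dilation (sqrt (real (n + d))) p)) i =
      fact (n + i) / fact i * ((s ^ (n + d) * (1 / s) ^ (n + i)) * coeff p (n + i))"
    unfolding coeff_higher_pderiv pochhammer_Suc_eq_fact dilation_def s_def
    by (simp add: coeff_pcompose_linear deg add.commute mult.assoc)
  moreover have "n + d - k = n + i" using d by simp
  ultimately show ?thesis
    unfolding pw falling_factorial_eq_pochhammer pochhammer_Suc_eq_fact s_def [symmetric] k_def [symmetric] c
    by (simp add: add.commute mult_ac)
qed

section \<open>Convergence to the Hermite polynomial\<close>

theorem theorem2p10:
  fixes d :: nat and P :: "nat \<Rightarrow> complex poly"
  assumes monic: "\<And>m. m > 0 \<Longrightarrow> lead_coeff (P m) = 1"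
    and deg: "\<And>m. m > 0 \<Longrightarrow> degree (P m) = m"
    and real_rooted: "\<And>m z. m > 0 \<Longrightarrow> poly (P m) z = 0 \<Longrightarrow> z \<in> \<real>"
    and m1: "(\<lambda>m. root_moment 1 (P m)) \<in> o(\<lambda>m. of_real (real m powr (- 1 / 2)))"
    and m2: "(\<lambda>m. root_moment 2 (P m)) \<longlonglongrightarrow> 1"
    and abs_m: "\<exists>\<epsilon>>0. (\<lambda>m. abs_root_moment (2 + \<epsilon>) (P m)) \<in> o(\<lambda>m. real m powr (\<epsilon> / 2))"
  shows "\<forall>K. compact K \<longrightarrow>
    uniform_limit K
      (\<lambda>n z. 1 / of_int (falling_factorial (n + d) n)
               * poly ((pderiv ^^ n) (dilation (sqrt (real (n + d))) (P (d + n)))) z)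
      (\<lambda>z. poly (hermite_poly d) z)
      sequentially"
proof -
  obtain \<epsilon> where eps: "\<epsilon> > 0"
    and abs_o: "(\<lambda>m. abs_root_moment (2 + \<epsilon>) (P m)) \<in> o(\<lambda>m. real m powr (\<epsilon> / 2))"
    using abs_m by blast
  define s where "s = (\<lambda>m. sqrt (real m))"
  define A where "A = (\<lambda>m. image_mset (\<lambda>z. z / of_real (s m)) (proots (P m)))"
  define q where "q = (\<lambda>m j. \<Sum>z\<in>#A m. z ^ j)"
  define T where "T = (\<lambda>m. \<Sum>z\<in>#A m. norm z powr (2 + \<epsilon>))"
  \<comment> \<open>For \<open>m > 0\<close> the coefficient of \<open>t ^ k\<close> in the product of \<open>1 - x t\<close> over \<open>x \<in># A m\<close>.\<close>
  define b where "b = (\<lambda>m k. coeff (reflect_poly (P m)) k / of_real (s m) ^ k)"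
  have q_eq: "q m j = (\<Sum>z\<in>#proots (P m). z ^ j) / of_real (s m) ^ j" for m j
    by (simp add: q_def A_def image_mset.compositionality o_def divide_inverse power_mult_distrib power_inverse
        sum_mset_distrib_right)
  have q_moment: "q m j = of_nat m * root_moment j (P m) / of_real (s m) ^ j" if "m > 0" for m j
    using that by (simp add: q_eq root_moment_def deg)
  have ev: "eventually (\<lambda>m. m > 0) sequentially" by (rule eventually_gt_at_top)

  have q1: "(\<lambda>m. q m 1) \<longlonglongrightarrow> 0"
  proof (rule Lim_transform_eventually)
    show "(\<lambda>m. root_moment 1 (P m) / of_real (real m powr (- 1 / 2))) \<longlonglongrightarrow> 0"
      using smalloD_tendsto [OF m1] by simp
    show "eventually (\<lambda>m. root_moment 1 (P m) / of_real (real m powr (- 1 / 2)) = q m 1) sequentially"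
      using ev
    proof eventually_elim
      case (elim m)
      have "real m powr (- 1 / 2) = s m / real m"
        using elim by (simp add: s_def powr_half_sqrt powr_minus real_div_sqrt field_simps)
      then show ?case using elim by (simp add: q_moment)
    qed
  qed

  have q2: "(\<lambda>m. q m 2) \<longlonglongrightarrow> 1"
  proof (rule Lim_transform_eventually [OF m2])
    show "eventually (\<lambda>m. root_moment 2 (P m) = q m 2) sequentially"
      using ev
    proof eventually_elim
      case (elim m)
      have "(of_real (s m) :: complex) ^ 2 = of_nat m" by (simp add: s_def flip: of_real_power)
      then show ?case using elim by (simp add: q_moment)
    qed
  qed

  have T_nonneg: "0 \<le> T m" for m
  proof -
    have "0 \<le> (\<Sum>z\<in>#B. norm z powr (2 + \<epsilon>))" for B :: "complex multiset" by (induction B) auto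
    then show ?thesis by (simp add: T_def)
  qed
  have T0: "T \<longlonglongrightarrow> 0"
  proof (rule Lim_transform_eventually [OF smalloD_tendsto [OF abs_o]])
    show "eventually (\<lambda>m. abs_root_moment (2 + \<epsilon>) (P m) / real m powr (\<epsilon> / 2) = T m) sequentially"
      using ev
    proof eventually_elim
      case (elim m)
      have "s m powr (2 + \<epsilon>) = real m * real m powr (\<epsilon> / 2)"
        using elim by (simp add: s_def powr_half_sqrt [symmetric] powr_powr powr_add add_divide_distrib)
      moreover have "T m = (\<Sum>z\<in>#proots (P m). norm z powr (2 + \<epsilon>)) / s m powr (2 + \<epsilon>)"
      proof -
        have "norm (z / of_real (s m)) powr (2 + \<epsilon>) = norm z powr (2 + \<epsilon>) * inverse (s m powr (2 + \<epsilon>))" for z :: complex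
          by (simp add: norm_divide powr_divide s_def divide_inverse [symmetric])
        then show ?thesis
          by (simp add: T_def A_def image_mset.compositionality o_def divide_inverse [of "sum_mset _"] sum_mset_distrib_right)
      qed
      ultimately show ?case using elim by (simp add: abs_root_moment_def deg)
    qed
  qed

  have q3: "(\<lambda>m. q m (j + 2)) \<longlonglongrightarrow> 0" if "j > 0" for j
  proof (rule Lim_null_comparison)
    have "(\<lambda>m. T m powr (1 / (2 + \<epsilon>))) \<longlonglongrightarrow> 0 powr (1 / (2 + \<epsilon>))"
      using eps by (intro tendsto_powr2 T0 tendsto_const) (auto simp: T_nonneg)
    then have "(\<lambda>m. (T m powr (1 / (2 + \<epsilon>))) ^ j * norm (q m 2)) \<longlonglongrightarrow> 0 ^ j * norm (1 :: complex)"
      by (intro tendsto_mult tendsto_power tendsto_norm q2) simp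
    then show "(\<lambda>m. (T m powr (1 / (2 + \<epsilon>))) ^ j * norm (q m 2)) \<longlonglongrightarrow> 0" using that by (simp add: zero_power)
    show "eventually (\<lambda>m. norm (q m (j + 2)) \<le> (T m powr (1 / (2 + \<epsilon>))) ^ j * norm (q m 2)) sequentially"
      using ev
    proof eventually_elim
      case (elim m)
      have "P m \<noteq> 0" using monic [OF elim] by auto
      then have "z \<in> \<real>" if "z \<in># A m" for z
        using that real_rooted [OF elim] by (auto simp: A_def)
      then show ?case unfolding q_def T_def using eps by (intro real_power_sum_le) auto
    qed
  qed

  have q_lim: "(\<lambda>m. q m (Suc j)) \<longlonglongrightarrow> (if j = 1 then 1 else 0)" for j
  proof -
    consider "j = 0" | "j = 1" | i where "j = Suc (Suc i)"
      by (metis One_nat_def not0_implies_Suc)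
    then show ?thesis
    proof cases
      case (3 i)
      then show ?thesis using q3 [of "Suc i"] by simp
    qed (use q1 q2 in \<open>simp_all add: numeral_2_eq_2\<close>)
  qed

  have b_lim: "(\<lambda>m. b m k) \<longlonglongrightarrow> gauss_coeff k" for k
  proof (rule Newton_recursion_limit [of b sequentially q])
    show "eventually (\<lambda>m. b m 0 = 1) sequentially"
      using ev by eventually_elim (simp add: b_def monic)
    show "eventually (\<lambda>m. of_nat (Suc k) * b m (Suc k) = - (\<Sum>j\<le>k. b m (k - j) * q m (Suc j))) sequentially" for k
      using ev
    proof eventually_elim
      case (elim m)
      have "b m (k - j) * q m (Suc j) =
          coeff (reflect_poly (P m)) (k - j) * (\<Sum>z\<in>#proots (P m). z ^ Suc j) / of_real (s m) ^ Suc k"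
        if "j \<le> k" for j
      proof -
        have "Suc k = (k - j) + Suc j" using that by simp
        then show ?thesis unfolding b_def q_eq by (metis power_add times_divide_times_eq)
      qed
      then have "- (\<Sum>j\<le>k. b m (k - j) * q m (Suc j)) =
          - (\<Sum>j\<le>k. coeff (reflect_poly (P m)) (k - j) * (\<Sum>z\<in>#proots (P m). z ^ Suc j)) / of_real (s m) ^ Suc k"
        by (simp add: sum_divide_distrib)
      also have "\<dots> = of_nat (Suc k) * coeff (reflect_poly (P m)) (Suc k) / of_real (s m) ^ Suc k"
        by (simp only: Newton_identity [OF monic [OF elim]])
      finally show ?case by (simp add: b_def)
    qed
  qed (rule q_lim)

  define R where "R = (\<lambda>n. smult (1 / of_int (falling_factorial (n + d) n))
      ((pderiv ^^ n) (dilation (sqrt (real (n + d))) (P (d + n)))))"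
  have R_deg: "eventually (\<lambda>n. degree (R n) \<le> d) sequentially"
    using ev
  proof eventually_elim
    case (elim n)
    have "degree (dilation (sqrt (real (n + d))) (P (d + n))) \<le> d + n"
      using elim deg [of "d + n"] by (auto simp: dilation_def degree_pcompose intro!: order_trans [OF degree_smult_le])
    then show ?case by (auto simp: R_def degree_higher_pderiv)
  qed
  have R_lim: "(\<lambda>n. coeff (R n) i) \<longlonglongrightarrow> coeff (hermite_poly d) i" if i: "i \<le> d" for i
  proof (rule Lim_transform_eventually)
    have "(\<lambda>n. fact d / fact i * (of_nat (n + d) ^ (d - i) * fact (n + d - (d - i)) / fact (n + d)) * b (n + d) (d - i))
       \<longlonglongrightarrow> fact d / fact i * 1 * gauss_coeff (d - i)"
      by (intro tendsto_mult tendsto_const LIMSEQ_ignore_initial_segment [OF b_lim]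
          LIMSEQ_ignore_initial_segment [OF fact_ratio_tendsto])
    then show "(\<lambda>n. fact d / fact i * (of_nat (n + d) ^ (d - i) * fact (n + d - (d - i)) / fact (n + d)) * b (n + d) (d - i))
       \<longlonglongrightarrow> coeff (hermite_poly d) i"
      using i by (simp add: coeff_hermite_poly)
    show "eventually (\<lambda>n. fact d / fact i * (of_nat (n + d) ^ (d - i) * fact (n + d - (d - i)) / fact (n + d)) * b (n + d) (d - i)
        = coeff (R n) i) sequentially"
      using ev
    proof eventually_elim
      case (elim n)
      then have pos: "n + d > 0" by simp
      show ?case
        unfolding R_def coeff_smult add.commute [of d n] coeff_rescaled_derivative [OF deg [OF pos] pos i] b_def s_def ..
    qed
  qed
  have H_deg: "degree (hermite_poly d) \<le> d"
    by (rule degree_le) (auto simp: coeff_hermite_poly)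
  show ?thesis
  proof (intro allI impI)
    fix K :: "complex set"
    assume "compact K"
    then have "uniform_limit K (\<lambda>n. poly (R n)) (poly (hermite_poly d)) sequentially"
      by (intro uniform_limit_poly [where d = d] R_deg H_deg R_lim)
    moreover have "(\<lambda>n. poly (R n)) = (\<lambda>n z. 1 / of_int (falling_factorial (n + d) n)
               * poly ((pderiv ^^ n) (dilation (sqrt (real (n + d))) (P (d + n)))) z)"
      by (simp add: R_def fun_eq_iff)
    ultimately show "uniform_limit K
      (\<lambda>n z. 1 / of_int (falling_factorial (n + d) n)
               * poly ((pderiv ^^ n) (dilation (sqrt (real (n + d))) (P (d + n)))) z)
      (\<lambda>z. poly (hermite_poly d) z)
      sequentially"
      by (simp only:)
  qed
qed

end
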